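(* Let $A$ be an associative $R$-algebra and $M$ a bimodule over $A$. Given a maximal commutative subalgebra $C$ of $A$, the filtration $F^C$ makes the differential hull $D^CA$ almost commutative and the bimodule $D^CM$ over $D^CA$ almost symmetric.
   Context: Conventions. $R$ is a noetherian commutative ring of characteristic 0; all rings are unital and all (bi)modules are unitary; bimodules over $R$-algebras are symmetric over $R$. Almost commutative / almost symmetric. A $\mathbb{Z}$-filtered associative $R$-algebra $A'$ ($F_{p-1}A'\subset F_pA'$, $\bigcap_pF_pA'=0$, $\bigcup_pF_pA'=A'$) is almost commutative if its associated graded algebra is commutative; this means that $F_{p_0}A'\cdot F_{p_1}A'\subset F_{p_0+p_1}A'$ and $[F_{p_0}A',F_{p_1}A']\subset F_{p_0+p_1-1}A'$. A $\mathbb{Z}$-filtered $A'$-bimodule $M'$, symmetric over $R$ ($F_{p-1}M'\subset F_pM'$, $\bigcap_pF_pM'=0$, $\bigcup_pF_pM'=M'$), is almost symmetric if its associated graded bimodule is symmetric; this means that $F_{p_0}A'\cdot F_{p_1}M',\ F_{p_0}M'\cdot F_{p_1}A'\subset F_{p_0+p_1}M'$ and $[F_{p_0}A',F_{p_1}M']\subset F_{p_0+p_1-1}M'$. The filtration $F^C$ and differential hulls. For $c\in C$, $m\in M$ put $\mathrm{ad}_c(m)=[c,m]=cm-mc$, and define the increasing $\mathbb{N}$-filtration $$F^C_pM=\{m\in M\mid \forall c\in C:\ \mathrm{ad}_c^{p+1}(m)=0\}\quad(p\ge0),$$ extended by $F^C_pM=0$ for $p<0$. The paper rewrites it equivalently,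 via polarization, as $F^C_pM=\{m\in M\mid\forall c_0,\dots,c_p\in C:\ \mathrm{ad}_{c_0}\cdots\mathrm{ad}_{c_p}(m)=0\}$. Taking $M=A$ gives $F^C_pA$. The differential hulls are $D^CA=\bigcup_pF^C_pA$ and $D^CM=\bigcup_pF^C_pM$, with the filtrations $F^C$.
   Formalization: For F^C defined by powers ad_c^{p+1}, the formal theorem assumes all positive integers invertible in R, since over Z the claim fails (e.g. for algebras of characteristic 2); for F^C in the polarized form it is proved for any R of characteristic 0. *)

theory Defs
  imports "HOL-Algebra.Algebra"
begin

text \<open>The locale \<^locale>\<open>algebra\<close> of the library requires a commutative multiplication, so
  associative algebras over a commutative ring are introduced separately.\<close>

locale assoc_algebra = module R A + ring A
  for R :: "('r, 'z) ring_scheme" (structure) and A :: "('r, 'a, 'x) module_scheme" +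
  assumes smult_mult_left:
      "\<lbrakk>r \<in> carrier R; a \<in> carrier A; b \<in> carrier A\<rbrakk>
        \<Longrightarrow> (r \<odot>\<^bsub>A\<^esub> a) \<otimes>\<^bsub>A\<^esub> b = r \<odot>\<^bsub>A\<^esub> (a \<otimes>\<^bsub>A\<^esub> b)"
    and smult_mult_right:
      "\<lbrakk>r \<in> carrier R; a \<in> carrier A; b \<in> carrier A\<rbrakk>
        \<Longrightarrow> a \<otimes>\<^bsub>A\<^esub> (r \<odot>\<^bsub>A\<^esub> b) = r \<odot>\<^bsub>A\<^esub> (a \<otimes>\<^bsub>A\<^esub> b)"

text \<open>As for \<^locale>\<open>module\<close>, the fields \<^const>\<open>monoid.mult\<close> and \<^const>\<open>monoid.one\<close> of a bimodule carry no
  meaning.\<close>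

record ('r, 'a, 'm) bimodule = "('r, 'm) module" +
  lact :: "'a \<Rightarrow> 'm \<Rightarrow> 'm"
  ract :: "'m \<Rightarrow> 'a \<Rightarrow> 'm"

text \<open>Unitary bimodules, symmetric over \<open>R\<close>: by the last four axioms (with \<open>a = \<one>\<close>), an element
  of \<open>R\<close> acts through \<open>A\<close> in the same way from either side, namely by \<^const>\<open>smult\<close>.\<close>

locale bimodule = assoc_algebra R A + M: module R M
  for R :: "('r, 'z) ring_scheme" (structure)
    and A :: "('r, 'a, 'x) module_scheme"
    and M :: "('r, 'a, 'm, 'y) bimodule_scheme" +
  assumes lact_closed:
      "\<lbrakk>a \<in> carrier A; m \<in> carrier M\<rbrakk> \<Longrightarrow> lact M a m \<in> carrier M"
    and ract_closed:
      "\<lbrakk>a \<in> carrier A; m \<in> carrier M\<rbrakk> \<Longrightarrow> ract M m a \<in> carrier M"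
    and lact_add_left:
      "\<lbrakk>a \<in> carrier A; b \<in> carrier A; m \<in> carrier M\<rbrakk>
        \<Longrightarrow> lact M (a \<oplus>\<^bsub>A\<^esub> b) m = lact M a m \<oplus>\<^bsub>M\<^esub> lact M b m"
    and lact_add_right:
      "\<lbrakk>a \<in> carrier A; m \<in> carrier M; n \<in> carrier M\<rbrakk>
        \<Longrightarrow> lact M a (m \<oplus>\<^bsub>M\<^esub> n) = lact M a m \<oplus>\<^bsub>M\<^esub> lact M a n"
    and ract_add_left:
      "\<lbrakk>a \<in> carrier A; m \<in> carrier M; n \<in> carrier M\<rbrakk>
        \<Longrightarrow> ract M (m \<oplus>\<^bsub>M\<^esub> n) a = ract M m a \<oplus>\<^bsub>M\<^esub> ract M n a"
    and ract_add_right: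
      "\<lbrakk>a \<in> carrier A; b \<in> carrier A; m \<in> carrier M\<rbrakk>
        \<Longrightarrow> ract M m (a \<oplus>\<^bsub>A\<^esub> b) = ract M m a \<oplus>\<^bsub>M\<^esub> ract M m b"
    and lact_mult:
      "\<lbrakk>a \<in> carrier A; b \<in> carrier A; m \<in> carrier M\<rbrakk>
        \<Longrightarrow> lact M (a \<otimes>\<^bsub>A\<^esub> b) m = lact M a (lact M b m)"
    and ract_mult:
      "\<lbrakk>a \<in> carrier A; b \<in> carrier A; m \<in> carrier M\<rbrakk>
        \<Longrightarrow> ract M m (a \<otimes>\<^bsub>A\<^esub> b) = ract M (ract M m a) b"
    and lact_ract:
      "\<lbrakk>a \<in> carrier A; b \<in> carrier A; m \<in> carrier M\<rbrakk>
        \<Longrightarrow> ract M (lact M a m) b = lact M a (ract M m b)"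
    and lact_one: "m \<in> carrier M \<Longrightarrow> lact M \<one>\<^bsub>A\<^esub> m = m"
    and ract_one: "m \<in> carrier M \<Longrightarrow> ract M m \<one>\<^bsub>A\<^esub> = m"
    and lact_smult_left:
      "\<lbrakk>r \<in> carrier R; a \<in> carrier A; m \<in> carrier M\<rbrakk>
        \<Longrightarrow> lact M (r \<odot>\<^bsub>A\<^esub> a) m = r \<odot>\<^bsub>M\<^esub> lact M a m"
    and lact_smult_right:
      "\<lbrakk>r \<in> carrier R; a \<in> carrier A; m \<in> carrier M\<rbrakk>
        \<Longrightarrow> lact M a (r \<odot>\<^bsub>M\<^esub> m) = r \<odot>\<^bsub>M\<^esub> lact M a m"
    and ract_smult_left:
      "\<lbrakk>r \<in> carrier R; a \<in> carrier A; m \<in> carrier M\<rbrakk>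
        \<Longrightarrow> ract M (r \<odot>\<^bsub>M\<^esub> m) a = r \<odot>\<^bsub>M\<^esub> ract M m a"
    and ract_smult_right:
      "\<lbrakk>r \<in> carrier R; a \<in> carrier A; m \<in> carrier M\<rbrakk>
        \<Longrightarrow> ract M m (r \<odot>\<^bsub>A\<^esub> a) = r \<odot>\<^bsub>M\<^esub> ract M m a"

definition regular_bimodule ::
    "('r, 'a, 'x) module_scheme \<Rightarrow> ('r, 'a, 'a) bimodule" where
  "regular_bimodule A =
    \<lparr>carrier = carrier A, monoid.mult = monoid.mult A, monoid.one = monoid.one A,
     ring.zero = ring.zero A, ring.add = ring.add A, smult = smult A,
     lact = monoid.mult A, ract = monoid.mult A\<rparr>"

definition comm_subalgebra ::
    "('r, 'z) ring_scheme \<Rightarrow> ('r, 'a, 'x) module_scheme \<Rightarrow> 'a set \<Rightarrow> bool" where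
  "comm_subalgebra R A C \<longleftrightarrow> subcring C A \<and> submodule C R A"

definition maximal_comm_subalgebra ::
    "('r, 'z) ring_scheme \<Rightarrow> ('r, 'a, 'x) module_scheme \<Rightarrow> 'a set \<Rightarrow> bool" where
  "maximal_comm_subalgebra R A C \<longleftrightarrow>
    comm_subalgebra R A C \<and> (\<forall>C'. comm_subalgebra R A C' \<and> C \<subseteq> C' \<longrightarrow> C' = C)"

definition bimodule_commutator ::
    "('r, 'a, 'm, 'y) bimodule_scheme \<Rightarrow> 'a \<Rightarrow> 'm \<Rightarrow> 'm" where
  "bimodule_commutator M a m = lact M a m \<ominus>\<^bsub>M\<^esub> ract M m a"

definition filtration ::
    "('r, 'z) ring_scheme \<Rightarrow> ('r, 'm, 'y) module_scheme \<Rightarrow> (int \<Rightarrow> 'm set) \<Rightarrow> bool" where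
  "filtration R M F \<longleftrightarrow>
    (\<forall>p. submodule (F p) R M) \<and> (\<forall>p. F (p - 1) \<subseteq> F p) \<and>
    (\<Inter>p. F p) = {\<zero>\<^bsub>M\<^esub>} \<and> (\<Union>p. F p) = carrier M"

text \<open>The unit is required to lie in degree \<open>0\<close>, so that the associated graded algebra is
  unital.\<close>

definition almost_commutative ::
    "('r, 'z) ring_scheme \<Rightarrow> ('r, 'a, 'x) module_scheme \<Rightarrow> (int \<Rightarrow> 'a set) \<Rightarrow> bool" where
  "almost_commutative R A F \<longleftrightarrow>
    assoc_algebra R A \<and> filtration R A F \<and> \<one>\<^bsub>A\<^esub> \<in> F 0 \<and>
    (\<forall>p q. \<forall>a \<in> F p. \<forall>b \<in> F q.
      a \<otimes>\<^bsub>A\<^esub> b \<in> F (p + q) \<and> (a \<otimes>\<^bsub>A\<^esub> b) \<ominus>\<^bsub>A\<^esub> (b \<otimes>\<^bsub>A\<^esub> a) \<in> F (p + q - 1))"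

definition almost_symmetric ::
    "('r, 'z) ring_scheme \<Rightarrow> ('r, 'a, 'x) module_scheme \<Rightarrow> (int \<Rightarrow> 'a set) \<Rightarrow>
      ('r, 'a, 'm, 'y) bimodule_scheme \<Rightarrow> (int \<Rightarrow> 'm set) \<Rightarrow> bool" where
  "almost_symmetric R A F M G \<longleftrightarrow>
    bimodule R A M \<and> filtration R M G \<and>
    (\<forall>p q. \<forall>a \<in> F p. \<forall>m \<in> G q.
      lact M a m \<in> G (p + q) \<and> ract M m a \<in> G (p + q) \<and>
      bimodule_commutator M a m \<in> G (p + q - 1))"

definition ad_filtration ::
    "('r, 'a, 'm, 'y) bimodule_scheme \<Rightarrow> 'a set \<Rightarrow> int \<Rightarrow> 'm set" where
  "ad_filtration M C p =
    (if p < 0 then {\<zero>\<^bsub>M\<^esub>}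
     else {m \<in> carrier M. \<forall>c \<in> C. (bimodule_commutator M c ^^ (nat p + 1)) m = \<zero>\<^bsub>M\<^esub>})"

text \<open>The polarized form of \<^const>\<open>ad_filtration\<close>: for \<open>cs = [c\<^sub>0, \<dots>, c\<^sub>p]\<close> the fold is
  the value at \<open>m\<close> of the composite of the commutator maps of \<open>c\<^sub>0, \<dots>, c\<^sub>p\<close>. For commutative
  \<open>C\<close> both filtrations agree if positive integers are invertible in the base ring, but not in
  general.\<close>

definition polarized_ad_filtration ::
    "('r, 'a, 'm, 'y) bimodule_scheme \<Rightarrow> 'a set \<Rightarrow> int \<Rightarrow> 'm set" where
  "polarized_ad_filtration M C p =
    (if p < 0 then {\<zero>\<^bsub>M\<^esub>}
     else {m \<in> carrier M. \<forall>cs. set cs \<subseteq> C \<and> length cs = nat p + 1 \<longrightarrow>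
             foldr (bimodule_commutator M) cs m = \<zero>\<^bsub>M\<^esub>})"

text \<open>The part of an algebra or bimodule exhausted by a filtration, with the restricted
  operations; for the two filtrations above this is the differential hull.\<close>

definition union_hull ::
    "('a, 'x) partial_object_scheme \<Rightarrow> (int \<Rightarrow> 'a set) \<Rightarrow> ('a, 'x) partial_object_scheme" where
  "union_hull N F = N\<lparr>carrier := (\<Union>p. F p)\<rparr>"

end

theory Submission
  imports Defs
begin

text \<open>
  An element \<open>m\<close> lies in the polarized filtration in degree \<open>p \<ge> 0\<close> iff every commutator \<open>[c, m]\<close> with
  \<open>c \<in> C\<close> lies in degree \<open>p - 1\<close>. Since \<open>[c, _]\<close> is a derivation for both actions and satisfies the
  Jacobi identity, the bounds for \<open>am\<close>, \<open>ma\<close> and \<open>[a, m]\<close> follow by induction on the two degrees. The only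
  case of the last one not covered by the induction is that both degrees are \<open>0\<close>; there \<open>a\<close> centralizes
  \<open>C\<close>, hence lies in \<open>C\<close> by maximality, and so commutes with \<open>m\<close>.

  The unpolarized filtration coincides with the polarized one when positive integers are invertible:
  if \<open>(d + t e)^(n + 1)\<close> annihilates \<open>m\<close> for all natural \<open>t\<close>, where \<open>d\<close> and \<open>e\<close> are commuting additive
  maps, then all coefficients of this polynomial in \<open>t\<close> annihilate \<open>m\<close>, in particular the linear one,
  \<open>(n + 1) d^n e\<close>.
\<close>

(* Otherwise every scalar multiple [n] \<cdot> x is ambiguous with a product of ideals. *)
no_notation ideal_prod (infixl \<open>\<cdot>\<index>\<close> 80)

section \<open>Polarization\<close>

lemma (in abelian_monoid) add_pow_finsum:
  assumes "finite I" and "f \<in> I \<rightarrow> carrier G"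
  shows "[(k::nat)] \<cdot>\<^bsub>G\<^esub> (\<Oplus>\<^bsub>G\<^esub>i\<in>I. f i) = (\<Oplus>\<^bsub>G\<^esub>i\<in>I. [k] \<cdot>\<^bsub>G\<^esub> f i)"
  using assms by (induction I rule: finite_induct) (simp_all add: Pi_iff add.nat_pow_distrib)

text \<open>A substitute for the Vandermonde determinant: induction on the degree bound, where each
  elimination multiplies the remaining coefficients by positive integers that torsion-freeness
  cancels.\<close>

lemma (in abelian_group) vanishing_coefficients:
  assumes torsion_free: "\<And>(n::nat) x. n > 0 \<Longrightarrow> x \<in> carrier G \<Longrightarrow> [n] \<cdot>\<^bsub>G\<^esub> x = \<zero>\<^bsub>G\<^esub> \<Longrightarrow> x = \<zero>\<^bsub>G\<^esub>"
    and "\<And>j. a j \<in> carrier G"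
    and "\<And>t::nat. (\<Oplus>\<^bsub>G\<^esub>j\<in>{..r}. [(t ^ j)] \<cdot>\<^bsub>G\<^esub> a j) = \<zero>\<^bsub>G\<^esub>"
    and "j \<le> r"
  shows "a j = \<zero>\<^bsub>G\<^esub>"
  using assms(2-4)
proof (induction r arbitrary: a j)
  case 0
  from 0(2)[of 1] 0(1) 0(3) show ?case by simp
next
  case (Suc r)
  note a = Suc.prems(1)
  \<comment> \<open>Comparing \<open>f (2 * t)\<close> with \<open>2 ^ Suc r\<close> times \<open>f t\<close> eliminates the leading coefficient.\<close>
  define b where "b i = [(2 ^ Suc r - 2 ^ i :: nat)] \<cdot>\<^bsub>G\<^esub> a i" for i
  have b: "b i \<in> carrier G" for i using a by (simp add: b_def)
  have key: "[(t ^ i)] \<cdot>\<^bsub>G\<^esub> b i \<oplus>\<^bsub>G\<^esub> [((2 * t) ^ i)] \<cdot>\<^bsub>G\<^esub> a i = [(2 ^ Suc r :: nat)] \<cdot>\<^bsub>G\<^esub> ([(t ^ i)] \<cdot>\<^bsub>G\<^esub> a i)"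
    if "i \<le> Suc r" for i and t :: nat
  proof -
    \<comment> \<open>Subtraction of naturals is truncated, so the bound on \<open>i\<close> matters
      here.\<close>
    have "(2::nat) ^ i \<le> 2 ^ Suc r" using that by (intro power_increasing) auto
    then have "(2 ^ Suc r - 2 ^ i) * t ^ i + (2 * t) ^ i = t ^ i * 2 ^ Suc r"
      unfolding power_mult_distrib by (simp add: diff_mult_distrib)
    then show ?thesis
      using a by (simp add: b_def add.nat_pow_pow add.nat_pow_mult)
  qed
  have "(\<Oplus>\<^bsub>G\<^esub>i\<in>{..r}. [(t ^ i)] \<cdot>\<^bsub>G\<^esub> b i) = \<zero>\<^bsub>G\<^esub>" for t :: nat
  proof -
    \<comment> \<open>The term for \<open>Suc r\<close> may be added, because the integer factor in
      \<open>b (Suc r)\<close> is \<open>0\<close>.\<close>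
    have "(\<Oplus>\<^bsub>G\<^esub>i\<in>{..r}. [(t ^ i)] \<cdot>\<^bsub>G\<^esub> b i)
        = (\<Oplus>\<^bsub>G\<^esub>i\<in>{..Suc r}. [(t ^ i)] \<cdot>\<^bsub>G\<^esub> b i)"
      using b by (simp add: finsum_Suc) (simp add: b_def)
    \<comment> \<open>The second sum is the given polynomial at \<open>2 * t\<close>, hence
      zero.\<close>
    also have "\<dots> = (\<Oplus>\<^bsub>G\<^esub>i\<in>{..Suc r}. [(t ^ i)] \<cdot>\<^bsub>G\<^esub> b i) \<oplus>\<^bsub>G\<^esub> (\<Oplus>\<^bsub>G\<^esub>i\<in>{..Suc r}. [((2 * t) ^ i)] \<cdot>\<^bsub>G\<^esub> a i)"
      unfolding Suc.prems(2) using b by (simp del: finsum_Suc)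
    also have "\<dots> = (\<Oplus>\<^bsub>G\<^esub>i\<in>{..Suc r}. [(t ^ i)] \<cdot>\<^bsub>G\<^esub> b i \<oplus>\<^bsub>G\<^esub> [((2 * t) ^ i)] \<cdot>\<^bsub>G\<^esub> a i)"
      using a b by (intro finsum_addf[symmetric]) auto
    also have "\<dots> = (\<Oplus>\<^bsub>G\<^esub>i\<in>{..Suc r}. [(2 ^ Suc r :: nat)] \<cdot>\<^bsub>G\<^esub> ([(t ^ i)] \<cdot>\<^bsub>G\<^esub> a i))"
      using a key by (intro finsum_cong') auto
    also have "\<dots> = [(2 ^ Suc r :: nat)] \<cdot>\<^bsub>G\<^esub> (\<Oplus>\<^bsub>G\<^esub>i\<in>{..Suc r}. [(t ^ i)] \<cdot>\<^bsub>G\<^esub> a i)"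
      using a by (intro add_pow_finsum[symmetric]) auto
    finally show ?thesis unfolding Suc.prems(2) by simp
  qed
  then have b0: "b i = \<zero>\<^bsub>G\<^esub>" if "i \<le> r" for i
    using Suc.IH b that by blast
  have a0: "a i = \<zero>\<^bsub>G\<^esub>" if "i \<le> r" for i
  proof -
    \<comment> \<open>Strictness makes the factor in \<open>b i\<close> positive, so it can be
      cancelled.\<close>
    have "(2::nat) ^ i < 2 ^ Suc r" using that by (intro power_strict_increasing) auto
    then show ?thesis
      using torsion_free[OF _ a, of "2 ^ Suc r - 2 ^ i" i] b0[OF that] by (simp add: b_def)
  qed
  \<comment> \<open>Once the lower coefficients are gone, evaluation at \<open>1\<close> isolates
    the leading one.\<close>
  have "(\<Oplus>\<^bsub>G\<^esub>i\<in>{..r}. [((1::nat) ^ i)] \<cdot>\<^bsub>G\<^esub> a i) = (\<Oplus>\<^bsub>G\<^esub>i\<in>{..r}. \<zero>\<^bsub>G\<^esub>)"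
    using a0 by (intro finsum_cong') auto
  then have "a (Suc r) = \<zero>\<^bsub>G\<^esub>"
    using Suc.prems(2)[of 1] a by (simp add: finsum_Suc)
  then show ?case using a0 Suc.prems(3) le_Suc_eq by blast
qed

section \<open>Additive maps and powers of the pencil \<open>d + t e\<close>\<close>

locale additive_endo = abelian_group G for G :: "('a, 'b) ring_scheme" (structure) and d :: "'a \<Rightarrow> 'a" +
  assumes endo_closed [simp]: "x \<in> carrier G \<Longrightarrow> d x \<in> carrier G"
    and endo_add: "x \<in> carrier G \<Longrightarrow> y \<in> carrier G \<Longrightarrow> d (x \<oplus> y) = d x \<oplus> d y"
begin

lemma endo_zero [simp]: "d \<zero> = \<zero>"
proof -
  have "d \<zero> \<oplus> d \<zero> = d \<zero>" using endo_add[of \<zero> \<zero>] by simp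
  then show ?thesis by (metis add.l_cancel_one endo_closed zero_closed)
qed

lemma endo_inv: "x \<in> carrier G \<Longrightarrow> d (\<ominus> x) = \<ominus> d x"
  using endo_add[of "\<ominus> x" x] by (intro minus_equality[symmetric]) (simp_all add: l_neg)

lemma endo_minus: "x \<in> carrier G \<Longrightarrow> y \<in> carrier G \<Longrightarrow> d (x \<ominus> y) = d x \<ominus> d y"
  by (simp add: minus_eq endo_add endo_inv)

lemma endo_add_pow: "x \<in> carrier G \<Longrightarrow> d ([(n::nat)] \<cdot> x) = [n] \<cdot> d x"
  by (induction n) (simp_all add: endo_add)

lemma endo_finsum:
  assumes "finite I" and "f \<in> I \<rightarrow> carrier G"
  shows "d (\<Oplus>i\<in>I. f i) = (\<Oplus>i\<in>I. d (f i))"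
  using assms by (induction I rule: finite_induct) (simp_all add: Pi_iff endo_add)

lemma funpow_closed [simp]: "x \<in> carrier G \<Longrightarrow> (d ^^ n) x \<in> carrier G"
  by (induction n) auto

end

text \<open>Induction on \<open>n\<close>, multiplying a polynomial in \<open>t\<close> by
  \<open>d + t e\<close>. Only the linear coefficient is wanted; the constant one is tracked because
  it enters the recursion for the linear one. The coefficients are chosen before \<open>t\<close>,
  hence do not depend on it.\<close>

lemma pencil_expansion:
  fixes G :: "('a, 'b) ring_scheme" (structure)
  assumes d: "additive_endo G d" and e: "additive_endo G e"
    and comm: "\<And>y. y \<in> carrier G \<Longrightarrow> d (e y) = e (d y)"
    and x: "x \<in> carrier G"
  shows "\<exists>b. (\<forall>j. b j \<in> carrier G) \<and> (\<forall>j>n. b j = \<zero>) \<and> b 0 = (d ^^ n) x \<and>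
    b (Suc 0) = [n] \<cdot> (d ^^ (n - 1)) (e x) \<and>
    (\<forall>t::nat. ((\<lambda>y. d y \<oplus> [t] \<cdot> e y) ^^ n) x = (\<Oplus>j\<in>{..n}. [(t ^ j)] \<cdot> b j))"
proof -
  interpret d: additive_endo G d by (rule d)
  interpret e: additive_endo G e by (rule e)
  have comm_pow: "(d ^^ k) (e x) = e ((d ^^ k) x)" for k
    using x comm by (induction k) simp_all
  show ?thesis
  proof (induction n)
    case 0
    show ?case
      \<comment> \<open>The default value zero also fits the linear coefficient, a multiple by
        \<open>0\<close>.\<close>
      using x by (intro exI[of _ "\<lambda>j. if j = 0 then x else \<zero>"]) simp
  next
    case (Suc n)
    then obtain b where b: "\<And>j. b j \<in> carrier G" and b_null: "\<And>j. j > n \<Longrightarrow> b j = \<zero>"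
      and b0: "b 0 = (d ^^ n) x" and b1: "b (Suc 0) = [n] \<cdot> (d ^^ (n - 1)) (e x)"
      and b_sum: "\<And>t::nat. ((\<lambda>y. d y \<oplus> [t] \<cdot> e y) ^^ n) x = (\<Oplus>j\<in>{..n}. [(t ^ j)] \<cdot> b j)"
      by blast
    \<comment> \<open>Collecting powers of \<open>t\<close> in the product of \<open>d + t e\<close>
      with the old polynomial.\<close>
    define b' where "b' j = (case j of 0 \<Rightarrow> d (b 0) | Suc i \<Rightarrow> d (b (Suc i)) \<oplus> e (b i))" for j
    have b': "b' j \<in> carrier G" for j
      using b by (simp add: b'_def split: nat.split)
    have "b' (Suc 0) = [(Suc n)] \<cdot> (d ^^ n) (e x)"
    proof -
      \<comment> \<open>For \<open>n = 0\<close> the truncated exponent \<open>n - 1\<close> is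
        harmless, since both sides are zero.\<close>
      have "d (b (Suc 0)) = [n] \<cdot> (d ^^ n) (e x)"
        using x by (cases n) (simp_all add: b1 d.endo_add d.endo_add_pow)
      then show ?thesis using x by (simp add: b'_def b0 comm_pow)
    qed
    moreover have "((\<lambda>y. d y \<oplus> [t] \<cdot> e y) ^^ Suc n) x = (\<Oplus>j\<in>{..Suc n}. [(t ^ j)] \<cdot> b' j)"
      for t :: nat
    proof -
      \<comment> \<open>As \<open>b (Suc n)\<close> is zero, the sum may run up to
        \<open>Suc n\<close>; splitting off the constant term then aligns it with the shifted sum in
        \<open>E\<close>.\<close>
      have "d (\<Oplus>j\<in>{..n}. [(t ^ j)] \<cdot> b j) = (\<Oplus>j\<in>{..Suc n}. [(t ^ j)] \<cdot> d (b j))"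
        using b by (simp add: d.endo_finsum d.endo_add_pow d.finsum_Suc b_null)
      also have "\<dots> = (\<Oplus>j\<in>{..n}. [(t ^ Suc j)] \<cdot> d (b (Suc j))) \<oplus> d (b 0)"
        using b by (subst d.finsum_Suc2) simp_all
      finally have D: "d (\<Oplus>j\<in>{..n}. [(t ^ j)] \<cdot> b j) =
        (\<Oplus>j\<in>{..n}. [(t ^ Suc j)] \<cdot> d (b (Suc j))) \<oplus> d (b 0)" .
      have E: "[t] \<cdot> e (\<Oplus>j\<in>{..n}. [(t ^ j)] \<cdot> b j) = (\<Oplus>j\<in>{..n}. [(t ^ Suc j)] \<cdot> e (b j))"
        using b by (simp add: e.endo_finsum e.endo_add_pow d.add_pow_finsum d.add.nat_pow_pow mult.commute)
      have "(\<Oplus>j\<in>{..Suc n}. [(t ^ j)] \<cdot> b' j) = (\<Oplus>j\<in>{..n}. [(t ^ Suc j)] \<cdot> b' (Suc j)) \<oplus> d (b 0)"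
        using b' b by (subst d.finsum_Suc2) (simp_all add: b'_def)
      also have "(\<Oplus>j\<in>{..n}. [(t ^ Suc j)] \<cdot> b' (Suc j)) =
          (\<Oplus>j\<in>{..n}. [(t ^ Suc j)] \<cdot> d (b (Suc j)) \<oplus> [(t ^ Suc j)] \<cdot> e (b j))"
        using b by (intro d.finsum_cong') (auto simp: b'_def d.add.nat_pow_distrib)
      also have "\<dots> = (\<Oplus>j\<in>{..n}. [(t ^ Suc j)] \<cdot> d (b (Suc j))) \<oplus> (\<Oplus>j\<in>{..n}. [(t ^ Suc j)] \<cdot> e (b j))"
        using b by (intro d.finsum_addf) auto
      finally have "(\<Oplus>j\<in>{..Suc n}. [(t ^ j)] \<cdot> b' j) =
          (\<Oplus>j\<in>{..n}. [(t ^ Suc j)] \<cdot> d (b (Suc j))) \<oplus> (\<Oplus>j\<in>{..n}. [(t ^ Suc j)] \<cdot> e (b j)) \<oplus> d (b 0)" .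
      with b show ?thesis
        by (simp add: b_sum D E d.a_ac del: power_Suc)
    qed
    ultimately show ?case
      using b' b0 b_null x by (intro exI[of _ b']) (auto simp: b'_def split: nat.split)
  qed
qed

text \<open>The linear coefficient of the pencil vanishes, and torsion-freeness cancels its factor
  \<open>Suc n\<close>. Applied to commutator maps, this shows that they lower the unpolarized
  degree.\<close>

lemma polarization:
  fixes G :: "('a, 'b) ring_scheme" (structure)
  assumes d: "additive_endo G d" and e: "additive_endo G e"
    and comm: "\<And>y. y \<in> carrier G \<Longrightarrow> d (e y) = e (d y)"
    and torsion_free: "\<And>(n::nat) x. n > 0 \<Longrightarrow> x \<in> carrier G \<Longrightarrow> [n] \<cdot> x = \<zero> \<Longrightarrow> x = \<zero>"
    and x: "x \<in> carrier G"
    and null: "\<And>t::nat. ((\<lambda>y. d y \<oplus> [t] \<cdot> e y) ^^ Suc n) x = \<zero>"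
  shows "(d ^^ n) (e x) = \<zero>"
proof -
  interpret d: additive_endo G d by (rule d)
  interpret e: additive_endo G e by (rule e)
  obtain b where b: "\<And>j. b j \<in> carrier G" and b1: "b (Suc 0) = [(Suc n)] \<cdot> (d ^^ n) (e x)"
    and sum: "\<And>t::nat. ((\<lambda>y. d y \<oplus> [t] \<cdot> e y) ^^ Suc n) x = (\<Oplus>j\<in>{..Suc n}. [(t ^ j)] \<cdot> b j)"
    using pencil_expansion[OF d e comm x, of "Suc n"] unfolding diff_Suc_1 by blast
  have "b (Suc 0) = \<zero>"
  proof (rule d.vanishing_coefficients)
    show "(\<Oplus>j\<in>{..Suc n}. [(t ^ j)] \<cdot> b j) = \<zero>" for t :: nat
      using null sum by metis
  qed (use torsion_free b in auto)
  moreover have "(d ^^ n) (e x) \<in> carrier G" using x by simp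
  ultimately show ?thesis
    using b1 torsion_free[of "Suc n" "(d ^^ n) (e x)"] by (metis zero_less_Suc)
qed


section \<open>Commutators in bimodules\<close>

lemma (in abelian_group) minus_unique':
  "\<lbrakk>x \<oplus> y = z; x \<in> carrier G; y \<in> carrier G\<rbrakk> \<Longrightarrow> x = z \<ominus> y"
  by (auto simp: minus_eq a_assoc r_neg)

lemma (in abelian_group) minus_eq_zero_iff:
  "\<lbrakk>x \<in> carrier G; y \<in> carrier G\<rbrakk> \<Longrightarrow> x \<ominus> y = \<zero> \<longleftrightarrow> x = y"
  by (metis a_inv_closed add.inv_solve_right' l_zero minus_eq zero_closed)

lemma (in abelian_group) minus_add_minus:
  "\<lbrakk>x \<in> carrier G; y \<in> carrier G; z \<in> carrier G\<rbrakk> \<Longrightarrow> (x \<ominus> y) \<oplus> (y \<ominus> z) = x \<ominus> z"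
  by (simp add: minus_eq a_assoc r_neg1)

lemma (in abelian_group) add_minus_add:
  "\<lbrakk>x \<in> carrier G; y \<in> carrier G; z \<in> carrier G; w \<in> carrier G\<rbrakk>
    \<Longrightarrow> (x \<oplus> y) \<ominus> (z \<oplus> w) = (x \<ominus> z) \<oplus> (y \<ominus> w)"
  by (simp add: minus_eq minus_add a_ac)

text \<open>Tailored to filtrations indexed by integers that are zero in negative degrees: these
  degrees are the base case.\<close>

lemma int_nonneg_induct:
  fixes p :: int
  assumes "\<And>p. p < 0 \<Longrightarrow> P p"
    and "\<And>p. p \<ge> 0 \<Longrightarrow> P (p - 1) \<Longrightarrow> P p"
  shows "P p"
\<comment> \<open>The shift by \<open>1\<close> makes the measure drop also from
  \<open>p = 0\<close> to \<open>-1\<close>.\<close>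
proof (induction "nat (p + 1)" arbitrary: p rule: less_induct)
  case less
  show ?case
    using assms less by (cases "p < 0") auto
qed

text \<open>The form suited to the Leibniz rule, whose two terms each lower one of the two
  degrees.\<close>

lemma int_nonneg_induct2:
  fixes p q :: int
  assumes "\<And>p q. p < 0 \<or> q < 0 \<Longrightarrow> P p q"
    and "\<And>p q. p \<ge> 0 \<Longrightarrow> q \<ge> 0 \<Longrightarrow> P (p - 1) q \<Longrightarrow> P p (q - 1) \<Longrightarrow> P p q"
  shows "P p q"
proof (induction "nat (p + 1) + nat (q + 1)" arbitrary: p q rule: less_induct)
  case less
  show ?case
    using assms less by (cases "p < 0 \<or> q < 0") auto
qed

section \<open>The regular bimodule\<close>

lemma regular_bimodule_simps [simp]:
  "carrier (regular_bimodule A) = carrier A" "\<zero>\<^bsub>regular_bimodule A\<^esub> = \<zero>\<^bsub>A\<^esub>"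
  "x \<oplus>\<^bsub>regular_bimodule A\<^esub> y = x \<oplus>\<^bsub>A\<^esub> y" "x \<ominus>\<^bsub>regular_bimodule A\<^esub> y = x \<ominus>\<^bsub>A\<^esub> y"
  "r \<odot>\<^bsub>regular_bimodule A\<^esub> x = r \<odot>\<^bsub>A\<^esub> x"
  "lact (regular_bimodule A) x y = x \<otimes>\<^bsub>A\<^esub> y" "ract (regular_bimodule A) x y = x \<otimes>\<^bsub>A\<^esub> y"
  by (simp_all add: regular_bimodule_def a_minus_def a_inv_def m_inv_def)

lemma bimodule_commutator_regular [simp]:
  "bimodule_commutator (regular_bimodule A) a b = a \<otimes>\<^bsub>A\<^esub> b \<ominus>\<^bsub>A\<^esub> b \<otimes>\<^bsub>A\<^esub> a"
  by (simp add: bimodule_commutator_def)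

text \<open>Serves to transfer the module structure of \<open>A\<close> to
  \<open>regular_bimodule A\<close>, a record of a different type with the same additive group and
  scalars.\<close>

lemma (in module) module_cong:
  assumes "carrier N = carrier M" "\<zero>\<^bsub>N\<^esub> = \<zero>\<^bsub>M\<^esub>" "\<And>x y. x \<oplus>\<^bsub>N\<^esub> y = x \<oplus>\<^bsub>M\<^esub> y"
    "\<And>r x. r \<odot>\<^bsub>N\<^esub> x = r \<odot>\<^bsub>M\<^esub> x"
  shows "module R N"
proof (rule moduleI)
  show "abelian_group N"
    by (rule abelian_groupI) (use assms add.l_inv_ex in \<open>auto simp: M.a_ac\<close>)
qed (use assms R.cring_axioms smult_l_distr smult_r_distr smult_assoc1 in auto)

lemma (in assoc_algebra) bimodule_regular: "bimodule R A (regular_bimodule A)"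
proof (intro bimodule.intro bimodule_axioms.intro)
  show "assoc_algebra R A" by (rule assoc_algebra_axioms)
  show "module R (regular_bimodule A)" by (rule module_cong) simp_all
qed (simp_all add: l_distr r_distr m_assoc smult_mult_left smult_mult_right)

section \<open>Commutator calculus\<close>

context bimodule
begin

abbreviation "ad \<equiv> bimodule_commutator M"

lemma ad_def: "ad c m = lact M c m \<ominus>\<^bsub>M\<^esub> ract M m c"
  by (rule bimodule_commutator_def)

lemma additive_endo_lact: "a \<in> carrier A \<Longrightarrow> additive_endo M (lact M a)"
  by unfold_locales (simp_all add: lact_closed lact_add_right)

lemma additive_endo_ract: "a \<in> carrier A \<Longrightarrow> additive_endo M (\<lambda>m. ract M m a)"
  by unfold_locales (simp_all add: ract_closed ract_add_left)

lemma additive_endo_ad: "c \<in> carrier A \<Longrightarrow> additive_endo M (ad c)"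
  by unfold_locales
    (simp_all add: ad_def lact_closed ract_closed lact_add_right ract_add_left M.add_minus_add)

lemma ad_closed [simp]: "\<lbrakk>c \<in> carrier A; m \<in> carrier M\<rbrakk> \<Longrightarrow> ad c m \<in> carrier M"
  by (simp add: ad_def lact_closed ract_closed)

lemma ad_smult: "\<lbrakk>r \<in> carrier R; c \<in> carrier A; m \<in> carrier M\<rbrakk> \<Longrightarrow> ad c (r \<odot>\<^bsub>M\<^esub> m) = r \<odot>\<^bsub>M\<^esub> ad c m"
  by (simp add: ad_def lact_closed ract_closed lact_smult_right ract_smult_left
      M.minus_eq M.smult_r_distr M.smult_r_minus)

lemma ad_add_left:
  "\<lbrakk>a \<in> carrier A; b \<in> carrier A; m \<in> carrier M\<rbrakk> \<Longrightarrow> ad (a \<oplus>\<^bsub>A\<^esub> b) m = ad a m \<oplus>\<^bsub>M\<^esub> ad b m"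
  by (simp add: ad_def lact_closed ract_closed lact_add_left ract_add_right M.add_minus_add)

lemma lact_zero_left: "m \<in> carrier M \<Longrightarrow> lact M \<zero>\<^bsub>A\<^esub> m = \<zero>\<^bsub>M\<^esub>"
  using lact_add_left[of "\<zero>\<^bsub>A\<^esub>" "\<zero>\<^bsub>A\<^esub>" m] lact_closed[of "\<zero>\<^bsub>A\<^esub>" m] by simp

lemma ract_zero_right: "m \<in> carrier M \<Longrightarrow> ract M m \<zero>\<^bsub>A\<^esub> = \<zero>\<^bsub>M\<^esub>"
  using ract_add_right[of "\<zero>\<^bsub>A\<^esub>" "\<zero>\<^bsub>A\<^esub>" m] ract_closed[of "\<zero>\<^bsub>A\<^esub>" m] by simp

lemma ad_zero_left: "m \<in> carrier M \<Longrightarrow> ad \<zero>\<^bsub>A\<^esub> m = \<zero>\<^bsub>M\<^esub>"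
  by (simp add: ad_def lact_zero_left ract_zero_right M.minus_eq M.r_neg)

lemma ad_add_pow_left:
  "\<lbrakk>a \<in> carrier A; m \<in> carrier M\<rbrakk> \<Longrightarrow> ad ([(n::nat)] \<cdot>\<^bsub>A\<^esub> a) m = [n] \<cdot>\<^bsub>M\<^esub> ad a m"
  by (induction n) (simp_all add: ad_zero_left ad_add_left)

lemma lact_minus_left:
  assumes "a \<in> carrier A" "b \<in> carrier A" "m \<in> carrier M"
  shows "lact M (a \<ominus>\<^bsub>A\<^esub> b) m = lact M a m \<ominus>\<^bsub>M\<^esub> lact M b m"
proof (rule M.minus_unique')
  have "a \<ominus>\<^bsub>A\<^esub> b \<oplus>\<^bsub>A\<^esub> b = a"
    using assms by (simp add: minus_eq a_assoc l_neg)
  then show "lact M (a \<ominus>\<^bsub>A\<^esub> b) m \<oplus>\<^bsub>M\<^esub> lact M b m = lact M a m"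
    using assms lact_add_left[of "a \<ominus>\<^bsub>A\<^esub> b" b m] by simp
qed (use assms in \<open>auto intro: lact_closed\<close>)

lemma ract_minus_right:
  assumes "a \<in> carrier A" "b \<in> carrier A" "m \<in> carrier M"
  shows "ract M m (a \<ominus>\<^bsub>A\<^esub> b) = ract M m a \<ominus>\<^bsub>M\<^esub> ract M m b"
proof (rule M.minus_unique')
  have "a \<ominus>\<^bsub>A\<^esub> b \<oplus>\<^bsub>A\<^esub> b = a"
    using assms by (simp add: minus_eq a_assoc l_neg)
  then show "ract M m (a \<ominus>\<^bsub>A\<^esub> b) \<oplus>\<^bsub>M\<^esub> ract M m b = ract M m a"
    using assms ract_add_right[of "a \<ominus>\<^bsub>A\<^esub> b" b m] by simp
qed (use assms in \<open>auto intro: ract_closed\<close>)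

text \<open>Leibniz rule for the left action: inserting \<open>a c m\<close> makes the sum
  telescope.\<close>

lemma ad_lact:
  assumes "c \<in> carrier A" "a \<in> carrier A" "m \<in> carrier M"
  shows "ad c (lact M a m) = lact M (c \<otimes>\<^bsub>A\<^esub> a \<ominus>\<^bsub>A\<^esub> a \<otimes>\<^bsub>A\<^esub> c) m \<oplus>\<^bsub>M\<^esub> lact M a (ad c m)"
  using assms
  by (simp add: ad_def lact_closed ract_closed lact_minus_left lact_mult lact_ract M.minus_add_minus
      additive_endo.endo_minus[OF additive_endo_lact])

text \<open>Leibniz rule for the right action; here \<open>m c a\<close> is the term that
  cancels.\<close>

lemma ad_ract:
  assumes "c \<in> carrier A" "a \<in> carrier A" "m \<in> carrier M"
  shows "ad c (ract M m a) = ract M (ad c m) a \<oplus>\<^bsub>M\<^esub> ract M m (c \<otimes>\<^bsub>A\<^esub> a \<ominus>\<^bsub>A\<^esub> a \<otimes>\<^bsub>A\<^esub> c)"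
  using assms
  by (simp add: ad_def lact_closed ract_closed ract_minus_right ract_mult lact_ract M.minus_add_minus
      additive_endo.endo_minus[OF additive_endo_ract])

text \<open>Jacobi identity, as the difference of the two Leibniz rules.\<close>

lemma ad_ad:
  assumes "c \<in> carrier A" "a \<in> carrier A" "m \<in> carrier M"
  shows "ad c (ad a m) = ad (c \<otimes>\<^bsub>A\<^esub> a \<ominus>\<^bsub>A\<^esub> a \<otimes>\<^bsub>A\<^esub> c) m \<oplus>\<^bsub>M\<^esub> ad a (ad c m)"
proof -
  interpret additive_endo M "ad c" by (rule additive_endo_ad) fact
  have "ad c (ad a m) = ad c (lact M a m) \<ominus>\<^bsub>M\<^esub> ad c (ract M m a)"
    using assms unfolding ad_def[of a] by (intro endo_minus) (simp_all add: lact_closed ract_closed)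
  also have "\<dots> = (lact M (c \<otimes>\<^bsub>A\<^esub> a \<ominus>\<^bsub>A\<^esub> a \<otimes>\<^bsub>A\<^esub> c) m \<oplus>\<^bsub>M\<^esub> lact M a (ad c m)) \<ominus>\<^bsub>M\<^esub>
      (ract M m (c \<otimes>\<^bsub>A\<^esub> a \<ominus>\<^bsub>A\<^esub> a \<otimes>\<^bsub>A\<^esub> c) \<oplus>\<^bsub>M\<^esub> ract M (ad c m) a)"
    using assms by (simp add: ad_lact ad_ract ract_closed M.a_comm)
  also have "\<dots> = ad (c \<otimes>\<^bsub>A\<^esub> a \<ominus>\<^bsub>A\<^esub> a \<otimes>\<^bsub>A\<^esub> c) m \<oplus>\<^bsub>M\<^esub> ad a (ad c m)"
    using assms unfolding ad_def[of a] ad_def[of "c \<otimes>\<^bsub>A\<^esub> a \<ominus>\<^bsub>A\<^esub> a \<otimes>\<^bsub>A\<^esub> c"]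
    by (intro M.add_minus_add) (simp_all add: lact_closed ract_closed)
  finally show ?thesis .
qed

section \<open>The polarized filtration\<close>

lemma polarized_ad_filtration_neg: "p < 0 \<Longrightarrow> polarized_ad_filtration M C p = {\<zero>\<^bsub>M\<^esub>}"
  by (simp add: polarized_ad_filtration_def)

text \<open>The last entry of the list is the innermost commutator, so it is the one split off. The
  later degree inductions rest on this recursion.\<close>

lemma mem_polarized_ad_filtration_iff:
  assumes "C \<subseteq> carrier A" and "p \<ge> 0"
  shows "m \<in> polarized_ad_filtration M C p \<longleftrightarrow>
    m \<in> carrier M \<and> (\<forall>c\<in>C. ad c m \<in> polarized_ad_filtration M C (p - 1))"
proof -
  define n where "n = nat p"
  have "(\<forall>cs. set cs \<subseteq> C \<and> length cs = Suc n \<longrightarrow> foldr ad cs m = \<zero>\<^bsub>M\<^esub>) \<longleftrightarrow>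
      (\<forall>c\<in>C. \<forall>cs. set cs \<subseteq> C \<and> length cs = n \<longrightarrow> foldr ad cs (ad c m) = \<zero>\<^bsub>M\<^esub>)" (is "?l \<longleftrightarrow> ?r")
  proof
    assume ?l
    show ?r
    proof (intro ballI allI impI)
      fix c cs assume "c \<in> C" "set cs \<subseteq> C \<and> length cs = n"
      with \<open>?l\<close>[rule_format, of "cs @ [c]"] show "foldr ad cs (ad c m) = \<zero>\<^bsub>M\<^esub>" by simp
    qed
  next
    assume ?r
    show ?l
    proof (intro allI impI)
      fix cs assume cs: "set cs \<subseteq> C \<and> length cs = Suc n"
      then obtain c cs' where "cs = cs' @ [c]" by (metis length_Suc_conv_rev)
      with cs \<open>?r\<close> show "foldr ad cs m = \<zero>\<^bsub>M\<^esub>" by auto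
    qed
  qed
  \<comment> \<open>For \<open>p = 0\<close> only the empty list remains; it forces \<open>x\<close>
    to be zero, in accordance with degree \<open>-1\<close>.\<close>
  moreover have "x \<in> polarized_ad_filtration M C (p - 1) \<longleftrightarrow>
      (\<forall>cs. set cs \<subseteq> C \<and> length cs = n \<longrightarrow> foldr ad cs x = \<zero>\<^bsub>M\<^esub>)" if "x \<in> carrier M" for x
    using assms(2) that by (cases "p = 0") (auto simp: polarized_ad_filtration_def n_def nat_diff_distrib)
  moreover have "ad c m \<in> carrier M" if "m \<in> carrier M" "c \<in> C" for c
    using that assms(1) by auto
  ultimately show ?thesis
    using assms(2) by (auto simp: polarized_ad_filtration_def n_def)
qed

lemma polarized_ad_filtration_subset: "polarized_ad_filtration M C p \<subseteq> carrier M"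
  by (auto simp: polarized_ad_filtration_def)

lemma submodule_zero: "submodule {\<zero>\<^bsub>M\<^esub>} R M"
  by (rule M.submoduleI) auto

lemma submodule_polarized_ad_filtration:
  assumes "C \<subseteq> carrier A"
  shows "submodule (polarized_ad_filtration M C p) R M"
proof (induction p rule: int_nonneg_induct)
  case (1 p)
  then show ?case by (simp add: polarized_ad_filtration_neg submodule_zero)
next
  case (2 p)
  note G = M.submoduleE[OF 2(2)] subgroup.one_closed[OF submodule.axioms(1)[OF 2(2)]]
  note endo = additive_endo_ad
  show ?case
    using assms G
    by (intro M.submoduleI)
      (auto simp: mem_polarized_ad_filtration_iff[OF assms 2(1)] ad_smult subset_iff
        additive_endo.endo_zero[OF endo] additive_endo.endo_add[OF endo] additive_endo.endo_inv[OF endo])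
qed

lemma polarized_ad_filtration_zero: "C \<subseteq> carrier A \<Longrightarrow> \<zero>\<^bsub>M\<^esub> \<in> polarized_ad_filtration M C p"
  using subgroup.one_closed[OF submodule.axioms(1)[OF submodule_polarized_ad_filtration]] by simp

lemma polarized_ad_filtration_mono:
  assumes "C \<subseteq> carrier A"
  shows "polarized_ad_filtration M C (p - 1) \<subseteq> polarized_ad_filtration M C p"
proof (induction p rule: int_nonneg_induct)
  case (1 p)
  then show ?case by (simp add: polarized_ad_filtration_neg)
next
  case (2 p)
  show ?case
  \<comment> \<open>For \<open>p = 0\<close> the smaller degree is \<open>-1\<close>, to which the
    recursion does not apply.\<close>
  proof (cases "p = 0")
    case True
    then show ?thesis
      using assms by (simp add: polarized_ad_filtration_neg polarized_ad_filtration_zero)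
  next
    case False
    with 2(1) have "p - 1 \<ge> 0" by simp
    with 2 show ?thesis
      by (auto simp only: subset_iff mem_polarized_ad_filtration_iff[OF assms])
  qed
qed

section \<open>Degrees of products and commutators\<close>

lemma polarized_ad_filtration_add:
  "\<lbrakk>C \<subseteq> carrier A; m \<in> polarized_ad_filtration M C p; n \<in> polarized_ad_filtration M C p\<rbrakk>
    \<Longrightarrow> m \<oplus>\<^bsub>M\<^esub> n \<in> polarized_ad_filtration M C p"
  using M.submoduleE(5)[OF submodule_polarized_ad_filtration] .

text \<open>In the Leibniz rule each term has one factor of degree lowered by one, so induction and
  the recursion apply. If a degree is negative, one factor is zero.\<close>

lemma lact_polarized_ad_filtration:
  assumes "C \<subseteq> carrier A"
    and "a \<in> polarized_ad_filtration (regular_bimodule A) C p" and "m \<in> polarized_ad_filtration M C q"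
  shows "lact M a m \<in> polarized_ad_filtration M C (p + q)"
  using assms(2,3)
proof (induction p q arbitrary: a m rule: int_nonneg_induct2)
  case (1 p q)
  interpret A: bimodule R A "regular_bimodule A" by (rule bimodule_regular)
  have "a \<in> carrier A" and "m \<in> carrier M"
    using 1(2,3) A.polarized_ad_filtration_subset polarized_ad_filtration_subset by fastforce+
  with 1 show ?case
    using polarized_ad_filtration_zero[OF assms(1)]
    by (auto simp: polarized_ad_filtration_neg A.polarized_ad_filtration_neg lact_zero_left
        additive_endo.endo_zero[OF additive_endo_lact])
next
  case (2 p q)
  interpret A: bimodule R A "regular_bimodule A" by (rule bimodule_regular)
  have a: "a \<in> carrier A" and m: "m \<in> carrier M"
    using 2(5,6) A.polarized_ad_filtration_subset polarized_ad_filtration_subset by fastforce+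
  have "ad c (lact M a m) \<in> polarized_ad_filtration M C (p + q - 1)" if "c \<in> C" for c
  proof -
    have "lact M (c \<otimes>\<^bsub>A\<^esub> a \<ominus>\<^bsub>A\<^esub> a \<otimes>\<^bsub>A\<^esub> c) m \<in> polarized_ad_filtration M C (p - 1 + q)"
      using 2 that A.mem_polarized_ad_filtration_iff[OF assms(1) 2(1)] by auto
    moreover have "lact M a (ad c m) \<in> polarized_ad_filtration M C (p + (q - 1))"
      using 2 that mem_polarized_ad_filtration_iff[OF assms(1) 2(2)] by auto
    ultimately show ?thesis
      using a m that assms(1)
      by (simp add: ad_lact subset_iff) (simp add: algebra_simps polarized_ad_filtration_add[OF assms(1)])
  qed
  then show ?case
    using a m 2(1,2) assms(1) by (simp add: mem_polarized_ad_filtration_iff lact_closed)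
qed

lemma ract_polarized_ad_filtration:
  assumes "C \<subseteq> carrier A"
    and "a \<in> polarized_ad_filtration (regular_bimodule A) C p" and "m \<in> polarized_ad_filtration M C q"
  shows "ract M m a \<in> polarized_ad_filtration M C (p + q)"
  using assms(2,3)
proof (induction p q arbitrary: a m rule: int_nonneg_induct2)
  case (1 p q)
  interpret A: bimodule R A "regular_bimodule A" by (rule bimodule_regular)
  have "a \<in> carrier A" and "m \<in> carrier M"
    using 1(2,3) A.polarized_ad_filtration_subset polarized_ad_filtration_subset by fastforce+
  with 1 show ?case
    using polarized_ad_filtration_zero[OF assms(1)]
    by (auto simp: polarized_ad_filtration_neg A.polarized_ad_filtration_neg ract_zero_right
        additive_endo.endo_zero[OF additive_endo_ract])
next
  case (2 p q)
  interpret A: bimodule R A "regular_bimodule A" by (rule bimodule_regular)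
  have a: "a \<in> carrier A" and m: "m \<in> carrier M"
    using 2(5,6) A.polarized_ad_filtration_subset polarized_ad_filtration_subset by fastforce+
  have "ad c (ract M m a) \<in> polarized_ad_filtration M C (p + q - 1)" if "c \<in> C" for c
  proof -
    have "ract M m (c \<otimes>\<^bsub>A\<^esub> a \<ominus>\<^bsub>A\<^esub> a \<otimes>\<^bsub>A\<^esub> c) \<in> polarized_ad_filtration M C (p - 1 + q)"
      using 2 that A.mem_polarized_ad_filtration_iff[OF assms(1) 2(1)] by auto
    moreover have "ract M (ad c m) a \<in> polarized_ad_filtration M C (p + (q - 1))"
      using 2 that mem_polarized_ad_filtration_iff[OF assms(1) 2(2)] by auto
    ultimately show ?thesis
      using a m that assms(1)
      by (simp add: ad_ract subset_iff) (simp add: algebra_simps polarized_ad_filtration_add[OF assms(1)])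
  qed
  then show ?case
    using a m 2(1,2) assms(1) by (simp add: mem_polarized_ad_filtration_iff ract_closed)
qed

text \<open>The same induction with the Jacobi identity. The second hypothesis says that the
  centralizer of \<open>C\<close> lies in \<open>C\<close>; it is what gains the extra
  degree.\<close>

lemma ad_polarized_ad_filtration:
  assumes "C \<subseteq> carrier A" and "polarized_ad_filtration (regular_bimodule A) C 0 \<subseteq> C"
    and "a \<in> polarized_ad_filtration (regular_bimodule A) C p" and "m \<in> polarized_ad_filtration M C q"
  shows "ad a m \<in> polarized_ad_filtration M C (p + q - 1)"
  using assms(3,4)
proof (induction p q arbitrary: a m rule: int_nonneg_induct2)
  case (1 p q)
  interpret A: bimodule R A "regular_bimodule A" by (rule bimodule_regular)
  have "a \<in> carrier A" and "m \<in> carrier M"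
    using 1(2,3) A.polarized_ad_filtration_subset polarized_ad_filtration_subset by fastforce+
  with 1 show ?case
    using polarized_ad_filtration_zero[OF assms(1)]
    by (auto simp: polarized_ad_filtration_neg A.polarized_ad_filtration_neg ad_zero_left
        additive_endo.endo_zero[OF additive_endo_ad])
next
  case (2 p q)
  interpret A: bimodule R A "regular_bimodule A" by (rule bimodule_regular)
  have a: "a \<in> carrier A" and m: "m \<in> carrier M"
    using 2(5,6) A.polarized_ad_filtration_subset polarized_ad_filtration_subset by fastforce+
  show ?case
  proof (cases "p = 0 \<and> q = 0")
    case True
    \<comment> \<open>The target degree is \<open>-1\<close>, but with \<open>a\<close> in
      \<open>C\<close> the recursion for \<open>m\<close> gives the claim directly.\<close>
    then have "a \<in> C" using 2(5) assms(2) by auto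
    with True 2(6) mem_polarized_ad_filtration_iff[OF assms(1)] show ?thesis by force
  next
    case False
    have "ad c (ad a m) \<in> polarized_ad_filtration M C (p + q - 1 - 1)" if "c \<in> C" for c
    proof -
      have "ad (c \<otimes>\<^bsub>A\<^esub> a \<ominus>\<^bsub>A\<^esub> a \<otimes>\<^bsub>A\<^esub> c) m \<in> polarized_ad_filtration M C (p - 1 + q - 1)"
        using 2 that A.mem_polarized_ad_filtration_iff[OF assms(1) 2(1)] by auto
      moreover have "ad a (ad c m) \<in> polarized_ad_filtration M C (p + (q - 1) - 1)"
        using 2 that mem_polarized_ad_filtration_iff[OF assms(1) 2(2)] by auto
      ultimately have "ad (c \<otimes>\<^bsub>A\<^esub> a \<ominus>\<^bsub>A\<^esub> a \<otimes>\<^bsub>A\<^esub> c) m \<oplus>\<^bsub>M\<^esub> ad a (ad c m)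
          \<in> polarized_ad_filtration M C (p + q - 1 - 1)"
        by (intro polarized_ad_filtration_add[OF assms(1)]) (simp_all add: algebra_simps)
      then show ?thesis
        using a m that assms(1) by (simp add: ad_ad[of c a m] subset_iff)
    qed
    moreover have "p + q - 1 \<ge> 0" using False 2(1,2) by linarith
    ultimately show ?thesis
      using a m assms(1) by (simp add: mem_polarized_ad_filtration_iff)
  qed
qed

section \<open>Comparison of the two filtrations\<close>

lemma ad_commute:
  assumes "c \<in> carrier A" "a \<in> carrier A" "c \<otimes>\<^bsub>A\<^esub> a = a \<otimes>\<^bsub>A\<^esub> c" "m \<in> carrier M"
  shows "ad c (ad a m) = ad a (ad c m)"
  using assms by (simp add: ad_ad[of c a m] minus_eq r_neg ad_zero_left)

text \<open>For \<open>d\<close> and \<open>e\<close> in \<open>C\<close> the maps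
  \<open>ad d\<close> and \<open>ad e\<close> commute, and their pencil is the commutator with
  \<open>d + t e\<close>, again an element of \<open>C\<close>. Thus \<open>polarization\<close>
  applies.\<close>

lemma ad_ad_filtration:
  assumes C: "subcring C A"
    and torsion_free: "\<And>(n::nat) x. n > 0 \<Longrightarrow> x \<in> carrier M \<Longrightarrow> [n] \<cdot>\<^bsub>M\<^esub> x = \<zero>\<^bsub>M\<^esub> \<Longrightarrow> x = \<zero>\<^bsub>M\<^esub>"
    and "p \<ge> 0" and m: "m \<in> ad_filtration M C p" and e: "e \<in> C"
  shows "ad e m \<in> ad_filtration M C (p - 1)"
proof -
  note C_sub = subsetD[OF subcringE(1)[OF C]]
  have mM: "m \<in> carrier M" and null: "\<And>c. c \<in> C \<Longrightarrow> (ad c ^^ Suc (nat p)) m = \<zero>\<^bsub>M\<^esub>"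
    using m \<open>p \<ge> 0\<close> by (auto simp: ad_filtration_def)
  have "(ad d ^^ nat p) (ad e m) = \<zero>\<^bsub>M\<^esub>" if d: "d \<in> C" for d
  proof (rule polarization[where d = "ad d" and e = "ad e" and x = m and n = "nat p"])
    show "additive_endo M (ad d)" "additive_endo M (ad e)"
      using additive_endo_ad C_sub d e by auto
    show "ad d (ad e y) = ad e (ad d y)" if "y \<in> carrier M" for y
      using that C_sub d e subcring.sub_m_comm[OF C d e] by (intro ad_commute) auto
    show "((\<lambda>y. ad d y \<oplus>\<^bsub>M\<^esub> [t] \<cdot>\<^bsub>M\<^esub> ad e y) ^^ Suc (nat p)) m = \<zero>\<^bsub>M\<^esub>" for t :: nat
    proof -
      have te: "[t] \<cdot>\<^bsub>A\<^esub> e \<in> C"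
        using e by (induction t) (auto intro: subcringE[OF C])
      then have dte: "d \<oplus>\<^bsub>A\<^esub> [t] \<cdot>\<^bsub>A\<^esub> e \<in> C"
        using d by (intro subcringE(7)[OF C])
      have eq: "ad (d \<oplus>\<^bsub>A\<^esub> [t] \<cdot>\<^bsub>A\<^esub> e) y = ad d y \<oplus>\<^bsub>M\<^esub> [t] \<cdot>\<^bsub>M\<^esub> ad e y" if "y \<in> carrier M" for y
        using that C_sub d e by (simp add: ad_add_left ad_add_pow_left)
      interpret additive_endo M "ad (d \<oplus>\<^bsub>A\<^esub> [t] \<cdot>\<^bsub>A\<^esub> e)"
        by (intro additive_endo_ad C_sub dte)
      \<comment> \<open>The two maps agree only on the carrier, so their powers are compared at
        \<open>m\<close>.\<close>
      have "((\<lambda>y. ad d y \<oplus>\<^bsub>M\<^esub> [t] \<cdot>\<^bsub>M\<^esub> ad e y) ^^ k) m = (ad (d \<oplus>\<^bsub>A\<^esub> [t] \<cdot>\<^bsub>A\<^esub> e) ^^ k) m" for k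
        using mM by (induction k) (simp_all add: eq)
      then show ?thesis using null[OF dte] by (simp only:)
    qed
  qed (use torsion_free mM in auto)
  moreover have "ad e m \<in> carrier M" using C_sub e mM by simp
  \<comment> \<open>In degree \<open>0\<close> the target is the zero submodule, and the hypothesis
    on \<open>m\<close> is a single commutator.\<close>
  moreover have "ad e m = \<zero>\<^bsub>M\<^esub>" if "p = 0" using null[OF e] that by simp
  moreover have "nat (p - 1) + 1 = nat p" if "p \<noteq> 0" using that \<open>p \<ge> 0\<close> by simp
  ultimately show ?thesis
    using \<open>p \<ge> 0\<close> unfolding ad_filtration_def by (cases "p = 0") auto
qed

text \<open>By \<open>ad_ad_filtration\<close> the unpolarized filtration obeys one half of the
  recursion, which gives one inclusion by induction. The other comes from constant lists.\<close>

lemma ad_filtration_eq_polarized: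
  assumes "subcring C A"
    and "\<And>(n::nat) x. n > 0 \<Longrightarrow> x \<in> carrier M \<Longrightarrow> [n] \<cdot>\<^bsub>M\<^esub> x = \<zero>\<^bsub>M\<^esub> \<Longrightarrow> x = \<zero>\<^bsub>M\<^esub>"
  shows "ad_filtration M C = polarized_ad_filtration M C"
proof
  fix p
  show "ad_filtration M C p = polarized_ad_filtration M C p"
  proof
    show "ad_filtration M C p \<subseteq> polarized_ad_filtration M C p"
    proof (induction p rule: int_nonneg_induct)
      case (1 p)
      then show ?case by (simp add: polarized_ad_filtration_neg ad_filtration_def)
    next
      case (2 p)
      show ?case
      proof
        fix m assume m: "m \<in> ad_filtration M C p"
        have "ad c m \<in> ad_filtration M C (p - 1)" if "c \<in> C" for c
          by (rule ad_ad_filtration[OF assms(1) _ 2(1) m that]) (rule assms(2))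
        moreover have "m \<in> carrier M"
          using m 2(1) by (simp add: ad_filtration_def)
        ultimately show "m \<in> polarized_ad_filtration M C p"
          using 2 by (auto simp: mem_polarized_ad_filtration_iff[OF subcringE(1)[OF assms(1)]])
      qed
    qed
    have foldr_replicate: "foldr ad (replicate n c) m = (ad c ^^ n) m" for n c m
      by (induction n) simp_all
    show "polarized_ad_filtration M C p \<subseteq> ad_filtration M C p"
    proof (cases "p < 0")
      case False
      have "(ad c ^^ (nat p + 1)) m = \<zero>\<^bsub>M\<^esub>"
        if m: "m \<in> polarized_ad_filtration M C p" and c: "c \<in> C" for m c
      proof -
        have "set (replicate (nat p + 1) c) \<subseteq> C \<and> length (replicate (nat p + 1) c) = nat p + 1"
          using c by auto
        with m False have "foldr ad (replicate (nat p + 1) c) m = \<zero>\<^bsub>M\<^esub>"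
          unfolding polarized_ad_filtration_def by (simp only: if_False mem_Collect_eq)
        then show ?thesis by (simp only: foldr_replicate)
      qed
      then show ?thesis
        using False polarized_ad_filtration_subset[of C p] unfolding ad_filtration_def[of M C p] by auto
    qed (simp add: polarized_ad_filtration_def ad_filtration_def)
  qed
qed

end


section \<open>Differential hulls\<close>

text \<open>Multiplication by \<open>n\<close> is scalar multiplication by the image of
  \<open>n\<close> in \<open>R\<close>, here a unit.\<close>

lemma (in module) torsion_free:
  assumes "[(n::nat)] \<cdot>\<^bsub>R\<^esub> \<one>\<^bsub>R\<^esub> \<in> Units R" and x: "x \<in> carrier M" and null: "[n] \<cdot>\<^bsub>M\<^esub> x = \<zero>\<^bsub>M\<^esub>"
  shows "x = \<zero>\<^bsub>M\<^esub>"
proof -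
  have smult: "([k] \<cdot>\<^bsub>R\<^esub> \<one>\<^bsub>R\<^esub>) \<odot>\<^bsub>M\<^esub> x = [k] \<cdot>\<^bsub>M\<^esub> x" for k :: nat
    using x by (induction k) (simp_all add: smult_l_distr)
  obtain u where u: "u \<in> carrier R" "u \<otimes>\<^bsub>R\<^esub> ([n] \<cdot>\<^bsub>R\<^esub> \<one>\<^bsub>R\<^esub>) = \<one>\<^bsub>R\<^esub>"
    using assms(1) by (auto simp: Units_def)
  have "x = (u \<otimes>\<^bsub>R\<^esub> ([n] \<cdot>\<^bsub>R\<^esub> \<one>\<^bsub>R\<^esub>)) \<odot>\<^bsub>M\<^esub> x" using u x by simp
  also have "\<dots> = u \<odot>\<^bsub>M\<^esub> ([n] \<cdot>\<^bsub>M\<^esub> x)"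
    using u(1) x smult_assoc1[of u "[n] \<cdot>\<^bsub>R\<^esub> \<one>\<^bsub>R\<^esub>" x] by (simp add: smult)
  finally show ?thesis using u null by simp
qed

section \<open>Restriction to submodules and subalgebras\<close>

lemma (in abelian_group) a_inv_restrict:
  assumes "subgroup H (add_monoid G)" and "x \<in> H"
  shows "\<ominus>\<^bsub>G\<lparr>carrier := H\<rparr>\<^esub> x = \<ominus> x"
  using group.m_inv_consistent[OF a_group assms] by (simp add: a_inv_def)

text \<open>Negatives are described within the carrier, so subtraction in a hull has to be
  identified with the ambient one.\<close>

lemma (in abelian_group) minus_restrict:
  assumes "subgroup H (add_monoid G)" and "y \<in> H"
  shows "x \<ominus>\<^bsub>G\<lparr>carrier := H\<rparr>\<^esub> y = x \<ominus> y"
  using a_inv_restrict[OF assms] by (simp add: a_minus_def)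

lemma (in module) submodule_restrict:
  assumes N: "submodule N R M" and "N \<subseteq> K" and K: "submodule K R M"
  shows "submodule N R (M\<lparr>carrier := K\<rparr>)"
proof -
  interpret K: module R "M\<lparr>carrier := K\<rparr>"
    by (rule submodule.submodule_is_module[OF K]) (rule module_axioms)
  show ?thesis
    using assms(2) submoduleE[OF N] subgroup.one_closed[OF submodule.axioms(1)[OF N]]
    by (intro K.submoduleI) (auto simp: a_inv_restrict[OF submodule.axioms(1)[OF K]])
qed

text \<open>The union is increasing, so two elements always lie in a common step
  \<open>F (max p q)\<close>.\<close>

lemma (in module) submodule_Union:
  fixes F :: "int \<Rightarrow> 'c set"
  assumes F: "\<And>p. submodule (F p) R M" and "\<And>p. F (p - 1) \<subseteq> F p"
  shows "submodule (\<Union>p. F p) R M"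
proof -
  have le: "F p \<subseteq> F q" if "p \<le> q" for p q
    using that assms(2)[of "_ + 1"] by (induction q rule: int_ge_induct) auto
  have add: "x \<oplus>\<^bsub>M\<^esub> y \<in> (\<Union>p. F p)" if "x \<in> F p" "y \<in> F q" for x y p q
    using that le[of p "max p q"] le[of q "max p q"] submoduleE(5)[OF F, of x "max p q" y] by auto
  show ?thesis
  proof (rule submoduleI)
    show "\<zero>\<^bsub>M\<^esub> \<in> (\<Union>p. F p)"
      using subgroup.one_closed[OF submodule.axioms(1)[OF F]] by auto
    show "x \<oplus>\<^bsub>M\<^esub> y \<in> (\<Union>p. F p)" if "x \<in> (\<Union>p. F p)" "y \<in> (\<Union>p. F p)" for x y
      using that by (elim UN_E) (rule add)
  qed (auto intro: submoduleE(1)[OF F, THEN subsetD] submoduleE(3,4)[OF F])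
qed

context assoc_algebra
begin

lemma subalgebra_restrict:
  assumes "subring H A" and "submodule H R A"
  shows "assoc_algebra R (A\<lparr>carrier := H\<rparr>)"
proof (intro assoc_algebra.intro assoc_algebra_axioms.intro)
  show "module R (A\<lparr>carrier := H\<rparr>)"
    by (rule submodule.submodule_is_module[OF assms(2)]) (rule module_axioms)
  show "ring (A\<lparr>carrier := H\<rparr>)" by (rule subring_is_ring) fact
qed (use subringE(1)[OF assms(1)] in \<open>auto simp: smult_mult_left smult_mult_right subset_iff\<close>)

section \<open>Centralizers and maximal commutative subalgebras\<close>

definition centralizer :: "'a set \<Rightarrow> 'a set"
  where "centralizer S = {a \<in> carrier A. \<forall>s\<in>S. a \<otimes>\<^bsub>A\<^esub> s = s \<otimes>\<^bsub>A\<^esub> a}"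

lemma subring_centralizer: "S \<subseteq> carrier A \<Longrightarrow> subring (centralizer S) A"
proof (rule subringI)
  fix a b assume S: "S \<subseteq> carrier A" and ab: "a \<in> centralizer S" "b \<in> centralizer S"
  have "a \<otimes>\<^bsub>A\<^esub> b \<otimes>\<^bsub>A\<^esub> s = s \<otimes>\<^bsub>A\<^esub> (a \<otimes>\<^bsub>A\<^esub> b)" if s: "s \<in> S" for s
  proof -
    have "a \<otimes>\<^bsub>A\<^esub> b \<otimes>\<^bsub>A\<^esub> s = a \<otimes>\<^bsub>A\<^esub> (s \<otimes>\<^bsub>A\<^esub> b)"
      using S ab s by (simp add: centralizer_def subset_iff m_assoc)
    also have "\<dots> = s \<otimes>\<^bsub>A\<^esub> (a \<otimes>\<^bsub>A\<^esub> b)"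
      using S ab s by (simp add: centralizer_def subset_iff flip: m_assoc)
    finally show ?thesis .
  qed
  then show "a \<otimes>\<^bsub>A\<^esub> b \<in> centralizer S"
    using ab by (simp add: centralizer_def)
qed (auto simp: centralizer_def subset_iff l_minus r_minus l_distr r_distr)

lemma submodule_centralizer: "S \<subseteq> carrier A \<Longrightarrow> submodule (centralizer S) R A"
  by (rule submoduleI)
    (auto simp: centralizer_def subset_iff l_minus r_minus l_distr r_distr smult_mult_left smult_mult_right)

text \<open>An element commuting with \<open>C\<close> lies with \<open>C\<close> in a common
  commutative subalgebra, which is \<open>C\<close> by maximality.\<close>

lemma centralizer_maximal_comm_subalgebra:
  assumes "maximal_comm_subalgebra R A C"
  shows "centralizer C = C"
proof
  have sub: "subcring C A" and max: "\<And>C'. comm_subalgebra R A C' \<Longrightarrow> C \<subseteq> C' \<Longrightarrow> C' = C"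
    using assms by (auto simp: maximal_comm_subalgebra_def comm_subalgebra_def)
  note C = subcringE(1)[OF sub] subcring.sub_m_comm[OF sub]
  show "C \<subseteq> centralizer C"
    using C by (auto simp: centralizer_def)
  show "centralizer C \<subseteq> C"
  proof
    fix a assume a: "a \<in> centralizer C"
    \<comment> \<open>The double centralizer of a commuting set is a commutative subalgebra.\<close>
    define D where "D = centralizer (centralizer (insert a C))"
    have carr: "centralizer S \<subseteq> carrier A" for S
      by (auto simp: centralizer_def)
    have ins: "insert a C \<subseteq> centralizer (insert a C)"
      using a C by (auto simp: centralizer_def)
    have "insert a C \<subseteq> D" "D \<subseteq> centralizer (insert a C)"
      using ins carr by (auto simp: D_def centralizer_def)
    \<comment> \<open>\<open>x\<close> commutes with the whole centralizer of
      \<open>insert a C\<close>, and \<open>y\<close> lies in it.\<close>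
    moreover from this have "x \<otimes>\<^bsub>A\<^esub> y = y \<otimes>\<^bsub>A\<^esub> x" if "x \<in> D" "y \<in> D" for x y
      using that by (auto simp: D_def centralizer_def)
    then have "comm_subalgebra R A D"
      unfolding comm_subalgebra_def D_def
      by (intro conjI subcringI subring_centralizer submodule_centralizer carr) auto
    ultimately show "a \<in> C" using max[of D] by auto
  qed
qed

end

lemma (in bimodule) bimodule_restrict:
  assumes H: "subring H A" "submodule H R A" and K: "submodule K R M"
    and "\<And>a m. a \<in> H \<Longrightarrow> m \<in> K \<Longrightarrow> lact M a m \<in> K"
    and "\<And>a m. a \<in> H \<Longrightarrow> m \<in> K \<Longrightarrow> ract M m a \<in> K"
  shows "bimodule R (A\<lparr>carrier := H\<rparr>) (M\<lparr>carrier := K\<rparr>)"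
proof (intro bimodule.intro bimodule_axioms.intro)
  show "assoc_algebra R (A\<lparr>carrier := H\<rparr>)" by (rule subalgebra_restrict) fact+
  show "module R (M\<lparr>carrier := K\<rparr>)"
    by (rule submodule.submodule_is_module[OF K]) (rule M.module_axioms)
qed (use assms(4,5) subringE(1)[OF H(1)] M.submoduleE(1)[OF K] in
  \<open>auto simp: subset_iff lact_add_left lact_add_right ract_add_left ract_add_right lact_mult ract_mult
    lact_ract lact_one ract_one lact_smult_left lact_smult_right ract_smult_left ract_smult_right\<close>)

section \<open>The hulls of the polarized filtration\<close>

context bimodule
begin

lemma filtration_polarized:
  assumes C: "C \<subseteq> carrier A"
  defines "G \<equiv> polarized_ad_filtration M C"
  shows "submodule (\<Union>p. G p) R M" "filtration R (union_hull M G) G"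
proof -
  show U: "submodule (\<Union>p. G p) R M"
    unfolding G_def
    by (rule M.submodule_Union) (rule submodule_polarized_ad_filtration[OF C] polarized_ad_filtration_mono[OF C])+
  have "(\<Inter>p. G p) = {\<zero>\<^bsub>M\<^esub>}"
    using polarized_ad_filtration_zero[OF C] polarized_ad_filtration_neg[of "-1" C] by (auto simp: G_def)
  moreover have "submodule (G p) R (M\<lparr>carrier := \<Union>p. G p\<rparr>)" for p
    by (rule M.submodule_restrict) (use U submodule_polarized_ad_filtration[OF C] in \<open>auto simp: G_def\<close>)
  ultimately show "filtration R (union_hull M G) G"
    using polarized_ad_filtration_mono[OF C] by (auto simp: filtration_def union_hull_def G_def)
qed

end

text \<open>All bounds are those for the regular bimodule, where both actions are multiplication and
  \<open>ad\<close> is the ring commutator.\<close>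

lemma (in assoc_algebra)
  assumes max: "maximal_comm_subalgebra R A C"
  defines "F \<equiv> polarized_ad_filtration (regular_bimodule A) C"
  shows polarized_ad_filtration_regular_zero: "F 0 = C"
    and subring_polarized_hull: "subring (\<Union>p. F p) A"
    and submodule_polarized_hull: "submodule (\<Union>p. F p) R A"
    and almost_commutative_polarized: "almost_commutative R (union_hull A F) F"
proof -
  interpret reg: bimodule R A "regular_bimodule A" by (rule bimodule_regular)
  have sub: "subcring C A"
    using max by (auto simp: maximal_comm_subalgebra_def comm_subalgebra_def)
  note C = subcringE(1)[OF sub]
  \<comment> \<open>By the recursion, degree \<open>0\<close> means that all commutators with
    \<open>C\<close> lie in degree \<open>-1\<close>, hence are zero.\<close>
  have "F 0 = centralizer C"
    using C by (auto simp: F_def centralizer_def reg.mem_polarized_ad_filtration_iff[OF C order_refl]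
        reg.polarized_ad_filtration_neg minus_eq_zero_iff subset_iff)
  then show F0: "F 0 = C" by (simp add: centralizer_maximal_comm_subalgebra[OF max])
  have one: "\<one>\<^bsub>A\<^esub> \<in> F 0" using F0 subcringE(3)[OF sub] by simp
  have "submodule (\<Union>p. F p) R (regular_bimodule A)" and filt: "filtration R (union_hull (regular_bimodule A) F) F"
    using reg.filtration_polarized[OF C] by (simp_all add: F_def)
  then show U: "submodule (\<Union>p. F p) R A"
    by (auto simp: submodule_def submodule_axioms_def subgroup_def a_inv_def regular_bimodule_def m_inv_def)
  have mult: "a \<otimes>\<^bsub>A\<^esub> b \<in> F (p + q)" if "a \<in> F p" "b \<in> F q" for a b p q
    using reg.lact_polarized_ad_filtration[OF C] that by (simp add: F_def)
  have comm: "a \<otimes>\<^bsub>A\<^esub> b \<ominus>\<^bsub>A\<^esub> b \<otimes>\<^bsub>A\<^esub> a \<in> F (p + q - 1)" if "a \<in> F p" "b \<in> F q" for a b p q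
    using reg.ad_polarized_ad_filtration[OF C] F0 that by (auto simp: F_def)
  show ring: "subring (\<Union>p. F p) A"
  proof (rule subringI)
    show "x \<otimes>\<^bsub>A\<^esub> y \<in> (\<Union>p. F p)" if xy: "x \<in> (\<Union>p. F p)" "y \<in> (\<Union>p. F p)" for x y
    proof -
      from xy obtain p q where "x \<in> F p" "y \<in> F q" by blast
      then show ?thesis using mult by blast
    qed
    show "\<one>\<^bsub>A\<^esub> \<in> (\<Union>p. F p)" using one by blast
  qed (fact submoduleE[OF U])+
  \<comment> \<open>\<open>filt\<close> concerns the hull of \<open>regular_bimodule A\<close>, so
    its submodule part is proved anew over the hull of \<open>A\<close>.\<close>
  have "submodule (F p) R (union_hull A F)" for p
    unfolding union_hull_def
    by (rule submodule_restrict)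
      (use U reg.submodule_polarized_ad_filtration[OF C, of p] in
        \<open>auto simp: F_def submodule_def submodule_axioms_def subgroup_def a_inv_def regular_bimodule_def m_inv_def\<close>)
  then have "filtration R (union_hull A F) F"
    using filt by (auto simp: filtration_def union_hull_def)
  moreover have "x \<ominus>\<^bsub>union_hull A F\<^esub> b \<otimes>\<^bsub>A\<^esub> a = x \<ominus>\<^bsub>A\<^esub> b \<otimes>\<^bsub>A\<^esub> a" if "a \<in> F p" "b \<in> F q" for x a b p q
    unfolding union_hull_def
    by (rule minus_restrict[OF submodule.axioms(1)[OF U]]) (use mult that in blast)
  moreover have "assoc_algebra R (union_hull A F)"
    using subalgebra_restrict[OF ring U] by (simp add: union_hull_def)
  moreover have "\<one>\<^bsub>union_hull A F\<^esub> = \<one>\<^bsub>A\<^esub>" "monoid.mult (union_hull A F) = monoid.mult A"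
    by (simp_all add: union_hull_def)
  ultimately show "almost_commutative R (union_hull A F) F"
    using one mult comm unfolding almost_commutative_def by metis
qed

lemma (in bimodule) almost_symmetric_polarized:
  assumes max: "maximal_comm_subalgebra R A C"
  defines "F \<equiv> polarized_ad_filtration (regular_bimodule A) C" and "G \<equiv> polarized_ad_filtration M C"
  shows "almost_symmetric R (union_hull A F) F (union_hull M G) G"
proof -
  have C: "C \<subseteq> carrier A"
    using max subcringE(1) by (auto simp: maximal_comm_subalgebra_def comm_subalgebra_def)
  note U = filtration_polarized(1)[OF C, folded G_def]
  have lact: "lact M a m \<in> G (p + q)" and ract: "ract M m a \<in> G (p + q)"
    and ad: "ad a m \<in> G (p + q - 1)" if "a \<in> F p" "m \<in> G q" for a m p q
    using lact_polarized_ad_filtration[OF C] ract_polarized_ad_filtration[OF C]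
      ad_polarized_ad_filtration[OF C] polarized_ad_filtration_regular_zero[OF max] that
    by (auto simp: F_def G_def)
  have "bimodule R (union_hull A F) (union_hull M G)"
    unfolding union_hull_def
  proof (rule bimodule_restrict)
    show "subring (\<Union>p. F p) A" "submodule (\<Union>p. F p) R A"
      unfolding F_def using max by (rule subring_polarized_hull submodule_polarized_hull)+
    fix a m assume "a \<in> (\<Union>p. F p)" "m \<in> (\<Union>p. G p)"
    then obtain p q where am: "a \<in> F p" "m \<in> G q" by blast
    show "lact M a m \<in> (\<Union>p. G p)" using lact[OF am] by blast
    show "ract M m a \<in> (\<Union>p. G p)" using ract[OF am] by blast
  qed (rule U)
  moreover have "filtration R (union_hull M G) G"
    unfolding G_def by (rule filtration_polarized(2)[OF C])
  moreover have "lact (union_hull M G) a m \<in> G (p + q) \<and> ract (union_hull M G) m a \<in> G (p + q) \<and>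
      bimodule_commutator (union_hull M G) a m \<in> G (p + q - 1)" if am: "a \<in> F p" "m \<in> G q" for a m p q
  proof -
    \<comment> \<open>Subtraction in the hull agrees with that of \<open>M\<close> once the
      subtrahend lies in the hull.\<close>
    have "ract M m a \<in> (\<Union>p. G p)" using ract[OF am] by blast
    then have "bimodule_commutator (union_hull M G) a m = ad a m"
      by (simp add: bimodule_commutator_def union_hull_def M.minus_restrict[OF submodule.axioms(1)[OF U]])
    with lact[OF am] ract[OF am] ad[OF am] show ?thesis by (simp add: union_hull_def)
  qed
  ultimately show ?thesis
    unfolding almost_symmetric_def by blast
qed

theorem theorem2:
  fixes R :: "('r, 'z) ring_scheme"
    and A :: "('r, 'a, 'x) module_scheme"
    and M :: "('r, 'a, 'm, 'y) bimodule_scheme"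
    and C :: "'a set"
  assumes "cring R"
    and "noetherian_ring R"
    and char_0: "\<And>n::nat. n > 0 \<Longrightarrow> [n] \<cdot>\<^bsub>R\<^esub> \<one>\<^bsub>R\<^esub> \<noteq> \<zero>\<^bsub>R\<^esub>"
    and "assoc_algebra R A"
    and "bimodule R A M"
    and "maximal_comm_subalgebra R A C"
  shows
    "((\<forall>n::nat. n > 0 \<longrightarrow> [n] \<cdot>\<^bsub>R\<^esub> \<one>\<^bsub>R\<^esub> \<in> Units R) \<longrightarrow>
        almost_commutative R
          (union_hull A (ad_filtration (regular_bimodule A) C)) (ad_filtration (regular_bimodule A) C) \<and>
        almost_symmetric R
          (union_hull A (ad_filtration (regular_bimodule A) C)) (ad_filtration (regular_bimodule A) C)
          (union_hull M (ad_filtration M C)) (ad_filtration M C)) \<and>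
     almost_commutative R
       (union_hull A (polarized_ad_filtration (regular_bimodule A) C))
       (polarized_ad_filtration (regular_bimodule A) C) \<and>
     almost_symmetric R
       (union_hull A (polarized_ad_filtration (regular_bimodule A) C))
       (polarized_ad_filtration (regular_bimodule A) C)
       (union_hull M (polarized_ad_filtration M C)) (polarized_ad_filtration M C)"
proof -
  interpret bimodule R A M by fact
  interpret reg: bimodule R A "regular_bimodule A" by (rule bimodule_regular)
  have C: "subcring C A"
    using assms(6) by (auto simp: maximal_comm_subalgebra_def comm_subalgebra_def)
  \<comment> \<open>Units make both \<open>A\<close> and \<open>M\<close> torsion-free, which
    reduces the first half of the claim to the second.\<close>
  have eq: "ad_filtration (regular_bimodule A) C = polarized_ad_filtration (regular_bimodule A) C"
    "ad_filtration M C = polarized_ad_filtration M C"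
    if "\<forall>n::nat. n > 0 \<longrightarrow> [n] \<cdot>\<^bsub>R\<^esub> \<one>\<^bsub>R\<^esub> \<in> Units R"
  proof -
    show "ad_filtration (regular_bimodule A) C = polarized_ad_filtration (regular_bimodule A) C"
      by (rule reg.ad_filtration_eq_polarized[OF C]) (rule reg.M.torsion_free, use that in auto)
    show "ad_filtration M C = polarized_ad_filtration M C"
      by (rule ad_filtration_eq_polarized[OF C]) (rule M.torsion_free, use that in auto)
  qed
  show ?thesis
    using almost_commutative_polarized[OF assms(6)] almost_symmetric_polarized[OF assms(6)] eq by simp
qed

end
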